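(* Let $k$ be a positive integer. If the set $\{1, 8k^2, 8k^2+1, d\}$ is a $D(-8k^2)$-quadruple, then $d = 32k^2+1$, and in that case $24k^2+1$ is a perfect square.
   Context: Let $n$ be a nonzero integer. A set of $m$ (distinct) positive integers $\{a_1, \dots, a_m\}$ is called a $D(n)$-$m$-tuple if $a_i a_j + n$ is a perfect square (the square of an integer, $0$ allowed) for all $1 \leq i < j \leq m$. A $D(n)$-quadruple is a $D(n)$-$4$-tuple. *)

theory Defs
  imports Main
begin

definition is_perfect_square :: "int \<Rightarrow> bool" where
  "is_perfect_square y \<longleftrightarrow> (\<exists>x::int. y = x ^ 2)"

definition D_tuple :: "int \<Rightarrow> nat \<Rightarrow> int set \<Rightarrow> bool" where
  "D_tuple n m S \<longleftrightarrow> finite S \<and> card S = m \<and> (\<forall>a\<in>S. a > 0) \<and>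
     (\<forall>a\<in>S. \<forall>b\<in>S. a \<noteq> b \<longrightarrow> is_perfect_square (a * b + n))"

abbreviation D_quadruple :: "int \<Rightarrow> int set \<Rightarrow> bool" where
  "D_quadruple n S \<equiv> D_tuple n 4 S"

end

theory Submission
  imports Defs "HOL-Computational_Algebra.Nth_Powers"
begin

text \<open>
  Put \<open>b = 8k\<^sup>2 + 1\<close>. The conditions on \<open>d\<close> read \<open>d = 2y\<^sup>2 + 1\<close>, \<open>z\<^sup>2 = 2by\<^sup>2 + 1\<close> and
  \<open>(z - 8k\<^sup>2)(z + 8k\<^sup>2) = bx\<^sup>2\<close>. Since \<open>2b = (4k)\<^sup>2 + 2\<close>, descent in the Pell equation gives
  \<open>16k\<^sup>2 | z - 1\<close> and \<open>b | z - 1\<close> or \<open>b | z + 1\<close>, so that the two factors are coprime and \<open>b\<close>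
  divides one of them; the other one, and the cofactor of \<open>b\<close>, are therefore squares.
  If \<open>b | z - 1\<close>, comparison with \<open>(z - 1)(z + 1) = 2by\<^sup>2\<close> yields two squares with difference 1,
  which forces \<open>d = 1\<close>.
  If \<open>b | z + 1\<close>, it yields \<open>z - 1 = w\<^sup>2\<close> and \<open>z + 8k\<^sup>2 = q\<^sup>2\<close>; as \<open>q\<^sup>2 - w\<^sup>2 = b\<close>, \<open>w\<close> is too
  small for any solution but the fundamental one \<open>z = 16k\<^sup>2 + 1\<close>.
\<close>

section \<open>Squares as products of coprime factors\<close>

lemma coprime_mult_eq_square_int:
  fixes m n x :: int
  assumes "coprime m n" "m * n = x\<^sup>2" "m \<ge> 0" "n \<ge> 0"
  shows "\<exists>r\<ge>0. m = r\<^sup>2" "\<exists>r\<ge>0. n = r\<^sup>2"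
proof -
  have cop: "coprime (nat m) (nat n)"
    using assms by (simp add: coprime_int_iff [symmetric])
  have "nat m * nat n = (nat \<bar>x\<bar>)\<^sup>2"
    using assms by (metis nat_mult_distrib nat_power_eq abs_ge_zero power2_abs)
  hence pow: "is_nth_power 2 (nat m * nat n)"
    by (simp add: is_nth_power_def)
  have "\<exists>r\<ge>0. l = r\<^sup>2" if l: "is_nth_power 2 (nat l)" "l \<ge> 0" for l :: int
  proof -
    obtain r where "nat l = r\<^sup>2"
      using l(1) by (auto elim: is_nth_powerE)
    hence "l = (int r)\<^sup>2"
      using l(2) by (metis int_nat_eq of_nat_power)
    thus ?thesis by (intro exI [of _ "int r"]) simp
  qed
  moreover have "is_nth_power 2 (nat m) \<and> is_nth_power 2 (nat n)"
  proof (cases "nat m > 0 \<and> nat n > 0")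
    case True
    thus ?thesis using is_nth_power_mult_coprime_natD [OF cop pow] by simp
  next
    case False
    \<comment> \<open>One factor is 0, so by coprimality the other is 1; both are squares.\<close>
    thus ?thesis using cop by auto
  qed
  ultimately show "\<exists>r\<ge>0. m = r\<^sup>2" "\<exists>r\<ge>0. n = r\<^sup>2"
    using assms(3,4) by blast+
qed

lemma coprime_one_plus_mult:
  fixes a t :: int
  shows "coprime a (1 + a * t)"
  by (rule coprimeI) (metis dvd_add_left_iff dvd_mult2)

lemma squares_differ_by_one:
  fixes p g :: int
  assumes "p\<^sup>2 - 1 = g\<^sup>2"
  shows "g = 0"
proof -
  have "(p - g) * (p + g) = 1"
    using assms by (simp add: algebra_simps power2_eq_square)
  hence "p - g = p + g"
    using zmult_eq_1_iff by auto
  thus ?thesis by simp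
qed

section \<open>Descent for the Pell equation z^2 = (a^2 + 2) y^2 + 1\<close>

lemma pell_square_plus_two_min:
  fixes a y z :: int
  assumes "a > 0" "y > 0" "z \<ge> 0" "z\<^sup>2 = (a\<^sup>2 + 2) * y\<^sup>2 + 1"
  shows "a \<le> y"
proof (rule ccontr)
  assume "\<not> a \<le> y"
  hence "y * y < a * y" using assms by simp
  have eq: "z\<^sup>2 = (a * y)\<^sup>2 + 2 * y\<^sup>2 + 1"
    using assms by (simp add: algebra_simps)
  have "(a * y)\<^sup>2 < z\<^sup>2"
    unfolding eq using zero_le_power2 [of y] by linarith
  \<comment> \<open>From y < a follows 2 y^2 + 1 < 2 a y + 1, so z^2 would lie strictly between
    consecutive squares.\<close>
  moreover have "z\<^sup>2 < (a * y + 1)\<^sup>2"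
    using eq \<open>y * y < a * y\<close> by (simp add: power2_eq_square algebra_simps)
  ultimately have "a * y < z" "z < a * y + 1"
    using assms(1-3) power2_less_imp_less [of "a * y" z] power2_less_imp_less [of z "a * y + 1"]
    by simp_all
  thus False by simp
qed

text \<open>A descent step turns z into -z modulo a^2 + 2, hence the disjunction. The conjunct
  \<open>a dvd y\<close> is carried along because the congruence modulo a^2 relies on it.\<close>

lemma pell_square_plus_two_cong:
  fixes a y z :: int
  assumes "a > 0" "y \<ge> 0" "z \<ge> 0" "z\<^sup>2 = (a\<^sup>2 + 2) * y\<^sup>2 + 1"
  shows "a dvd y \<and> a\<^sup>2 dvd z - 1 \<and> (a\<^sup>2 + 2 dvd z - 1 \<or> a\<^sup>2 + 2 dvd z + 1)"
  using assms(2-4)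
proof (induction "nat y" arbitrary: y z rule: less_induct)
  case less
  note pell = less.prems(3)
  show ?case
  proof (cases "y = 0")
    case True
    hence "z = 1" using less.prems by (simp add: power2_eq_1_iff)
    thus ?thesis using True by simp
  next
    case False
    hence "y > 0" using less.prems by simp
    \<comment> \<open>Division of z + y sqrt(a^2 + 2) by the unit a^2 + 1 + a sqrt(a^2 + 2), which
      has norm 1.\<close>
    define y' where "y' = (a\<^sup>2 + 1) * y - a * z"
    define z' where "z' = (a\<^sup>2 + 1) * z - (a\<^sup>2 + 2) * (a * y)"
    have pell': "z'\<^sup>2 = (a\<^sup>2 + 2) * y'\<^sup>2 + 1"
    proof -
      have "z'\<^sup>2 - (a\<^sup>2 + 2) * y'\<^sup>2 = z\<^sup>2 - (a\<^sup>2 + 2) * y\<^sup>2"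
        unfolding y'_def z'_def by algebra
      thus ?thesis using pell by simp
    qed
    \<comment> \<open>This bound keeps the descent from overshooting: it yields a z \<le> (a^2 + 1)
      y.\<close>
    have "a \<le> y"
      using pell_square_plus_two_min assms(1) \<open>y > 0\<close> less.prems by blast
    hence "a\<^sup>2 \<le> y\<^sup>2" using assms(1) by (intro power_mono) auto
    have "(a * z)\<^sup>2 = ((a\<^sup>2 + 1) * y)\<^sup>2 - y\<^sup>2 + a\<^sup>2"
      unfolding power_mult_distrib pell by algebra
    hence "(a * z)\<^sup>2 \<le> ((a\<^sup>2 + 1) * y)\<^sup>2" using \<open>a\<^sup>2 \<le> y\<^sup>2\<close> by simp
    hence "y' \<ge> 0"
      unfolding y'_def using less.prems(1) power2_le_imp_le by fastforce
    have "((a\<^sup>2 + 2) * (a * y))\<^sup>2 = ((a\<^sup>2 + 1) * z)\<^sup>2 - z\<^sup>2 - a\<^sup>2 * (a\<^sup>2 + 2)"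
      unfolding power_mult_distrib pell by algebra
    moreover have "0 \<le> z\<^sup>2" "0 \<le> a\<^sup>2 * (a\<^sup>2 + 2)" by simp_all
    ultimately have "((a\<^sup>2 + 2) * (a * y))\<^sup>2 \<le> ((a\<^sup>2 + 1) * z)\<^sup>2" by linarith
    hence "z' \<ge> 0"
      unfolding z'_def using less.prems(2) power2_le_imp_le by fastforce
    have "(a * y)\<^sup>2 < z\<^sup>2"
      unfolding pell power_mult_distrib using zero_le_power2 [of y]
      unfolding distrib_right by linarith
    hence "a * y < z"
      using less.prems(2) power2_less_imp_less by blast
    hence "a * (a * y) < a * z" using assms(1) by simp
    hence "y' < y" unfolding y'_def by (simp add: algebra_simps power2_eq_square)
    hence IH: "a dvd y'" "a\<^sup>2 dvd z' - 1" "a\<^sup>2 + 2 dvd z' - 1 \<or> a\<^sup>2 + 2 dvd z' + 1"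
      using less.hyps [of y' z'] \<open>y' \<ge> 0\<close> \<open>z' \<ge> 0\<close> \<open>y > 0\<close> pell' by auto
    have y: "y = y' + a * (z - a * y)"
      by (simp add: y'_def algebra_simps power2_eq_square)
    have "a dvd y" by (subst y) (use IH in simp)
    then obtain e where e: "y = a * e" by auto
    have "z - 1 = (z' - 1) + a\<^sup>2 * ((a\<^sup>2 + 2) * e - z)"
      unfolding z'_def e by algebra
    hence "a\<^sup>2 dvd z - 1" using IH(2) by (metis dvd_add dvd_triv_left)
    moreover have "z - 1 = (a\<^sup>2 + 2) * (z - a * y) - (z' + 1)"
      "z + 1 = (a\<^sup>2 + 2) * (z - a * y) - (z' - 1)"
      unfolding z'_def by algebra+
    hence "a\<^sup>2 + 2 dvd z - 1 \<or> a\<^sup>2 + 2 dvd z + 1"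
      using IH(3) by (metis dvd_diff dvd_triv_left)
    ultimately show ?thesis using \<open>a dvd y\<close> by blast
  qed
qed

section \<open>The two residue classes of z modulo 8 k^2 + 1\<close>

lemma coprime_pell_factors:
  fixes k z :: int
  assumes "16 * k\<^sup>2 dvd z - 1"
  shows "coprime (z - 8 * k\<^sup>2) (z + 8 * k\<^sup>2)"
proof -
  obtain m where "z - 1 = 16 * k\<^sup>2 * m" using assms by auto
  hence m: "z + 8 * k\<^sup>2 = 1 + 2 * k * (4 * k * (2 * m + 1))"
    by (simp add: algebra_simps power2_eq_square)
  have "coprime (z + 8 * k\<^sup>2) (2 * k)"
    unfolding m by (subst coprime_commute) (rule coprime_one_plus_mult)
  \<comment> \<open>The product is 16 k^2, the difference of the two factors, split into pieces
    already known to be coprime to z + 8 k^2.\<close>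
  hence "coprime (z + 8 * k\<^sup>2) (2 * k * (2 * k) * 2 * 2)"
    unfolding coprime_mult_right_iff by blast
  moreover have "2 * k * (2 * k) * 2 * 2 = (z + 8 * k\<^sup>2) - (z - 8 * k\<^sup>2)"
    by (simp add: power2_eq_square)
  ultimately have "coprime (z + 8 * k\<^sup>2) ((z + 8 * k\<^sup>2) - (z - 8 * k\<^sup>2))" by simp
  thus ?thesis
    by (metis coprime_def dvd_diff)
qed

text \<open>Let Q = (z - 1) / b. Then z + 8 k^2 = b (Q + 1) makes Q + 1 a square, and the Pell
  equation, in the form Q (b Q / 2 + 1) = y^2, makes Q a square. Hence Q = 0.\<close>

lemma pell_system_dvd_minus_one:
  fixes k x y z :: int
  assumes "z > 0" "16 * k\<^sup>2 dvd z - 1" "8 * k\<^sup>2 + 1 dvd z - 1"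
    and pell: "z\<^sup>2 = 2 * (8 * k\<^sup>2 + 1) * y\<^sup>2 + 1"
    and fac: "(z - 8 * k\<^sup>2) * (z + 8 * k\<^sup>2) = (8 * k\<^sup>2 + 1) * x\<^sup>2"
    and "z \<ge> 8 * k\<^sup>2"
  shows "y = 0"
proof -
  define b where "b = 8 * k\<^sup>2 + 1"
  have "b > 0" by (simp add: b_def add_pos_nonneg add.commute)
  obtain Q where Q: "z - 1 = b * Q" using assms(3) b_def by auto
  have zb: "z + 8 * k\<^sup>2 = b * (Q + 1)" using Q by (simp add: b_def algebra_simps)
  have "even (z - 1)" using assms(2) by (meson dvd_trans dvd_triv_left dvd_mult2 even_numeral)
  hence "even Q" using Q b_def by simp
  have "b * Q \<ge> 0" using Q \<open>z > 0\<close> by simp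
  hence "Q \<ge> 0" using \<open>b > 0\<close> by (simp add: zero_le_mult_iff)
  have "coprime (z - 8 * k\<^sup>2) (Q + 1)"
    using coprime_pell_factors [OF assms(2)] unfolding zb by simp
  moreover have "b * ((z - 8 * k\<^sup>2) * (Q + 1)) = b * x\<^sup>2"
    using fac unfolding zb b_def [symmetric] by (simp add: ac_simps)
  hence "(z - 8 * k\<^sup>2) * (Q + 1) = x\<^sup>2" using \<open>b > 0\<close> by simp
  ultimately obtain p where p: "Q + 1 = p\<^sup>2"
    using coprime_mult_eq_square_int(2) assms(6) \<open>Q \<ge> 0\<close>
    by (metis add_nonneg_nonneg diff_ge_0_iff_ge zero_le_one)
  obtain h where h: "Q = 2 * h" using \<open>even Q\<close> by auto
  have z: "z = 2 * (b * h) + 1" using Q h by simp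
  have "2 * b * (Q * (b * h + 1)) = 2 * b * y\<^sup>2"
    using pell unfolding b_def [symmetric] z h by algebra
  hence "Q * (b * h + 1) = y\<^sup>2" using \<open>b > 0\<close> by simp
  moreover have "coprime Q (b * h + 1)"
  proof -
    \<comment> \<open>Coprimality of 2 h and b h + 1 needs b h even, which comes from 16 k^2
      dividing z - 1 = 2 b h.\<close>
    have "2 * (8 * k\<^sup>2) dvd 2 * (b * h)" using assms(2) z by simp
    hence "8 * k\<^sup>2 dvd b * h" by (simp only: dvd_mult_cancel_left) simp
    hence "even (b * h)" by (meson dvd_trans dvd_triv_left dvd_mult2 even_numeral)
    hence "coprime 2 (b * h + 1)" by simp
    moreover have "coprime h (b * h + 1)"
      using coprime_one_plus_mult [of h b] by (simp add: ac_simps)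
    ultimately show ?thesis unfolding h by simp
  qed
  ultimately obtain g where "Q = g\<^sup>2"
    using coprime_mult_eq_square_int(1) [of Q "b * h + 1" y] \<open>Q \<ge> 0\<close> \<open>b > 0\<close> h by auto
  hence "Q = 0" using squares_differ_by_one [of p g] p by simp
  thus ?thesis using \<open>Q * (b * h + 1) = y\<^sup>2\<close> by simp
qed

text \<open>Let R = (z + 1) / (2 b). Then z - 8 k^2 = b (2 R - 1) makes z + 8 k^2 a square, and (z -
  1) R = y^2 makes z - 1 and R squares. The size of z - 1 forces R = 1, and then z + 8 k^2 is 24 k^2
  + 1.\<close>

lemma pell_system_dvd_plus_one:
  fixes k x y z :: int
  assumes "k > 0" "z > 0" "16 * k\<^sup>2 dvd z - 1" "8 * k\<^sup>2 + 1 dvd z + 1"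
    and pell: "z\<^sup>2 = 2 * (8 * k\<^sup>2 + 1) * y\<^sup>2 + 1"
    and fac: "(z - 8 * k\<^sup>2) * (z + 8 * k\<^sup>2) = (8 * k\<^sup>2 + 1) * x\<^sup>2"
    and "z \<ge> 8 * k\<^sup>2"
  shows "y\<^sup>2 = 16 * k\<^sup>2" "is_perfect_square (24 * k\<^sup>2 + 1)"
proof -
  define b where "b = 8 * k\<^sup>2 + 1"
  have "b > 0" by (simp add: b_def add_pos_nonneg add.commute)
  obtain m where m: "z - 1 = 16 * k\<^sup>2 * m" using assms(3) by auto
  obtain P where P: "z + 1 = b * P" using assms(4) b_def by auto
  have "b * P = 2 * (8 * k\<^sup>2 * m + 1)" using P m by simp
  hence "even (b * P)" by simp
  hence "even P" using b_def by simp
  then obtain R where R: "P = 2 * R" by auto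
  have bR: "b * R = 8 * k\<^sup>2 * m + 1" using P m R by simp
  have z: "z = 2 * (b * R) - 1" using P R by simp
  have "b * R > 0" using z \<open>z > 0\<close> by simp
  hence "R > 0" using \<open>b > 0\<close> by (simp add: zero_less_mult_iff)
  have zb: "z - 8 * k\<^sup>2 = b * (P - 1)" using P by (simp add: b_def algebra_simps)
  have "coprime (P - 1) (z + 8 * k\<^sup>2)"
    using coprime_pell_factors [OF assms(3)] unfolding zb by simp
  moreover have "b * ((P - 1) * (z + 8 * k\<^sup>2)) = b * x\<^sup>2"
    using fac unfolding zb b_def [symmetric] by (simp add: ac_simps)
  hence "(P - 1) * (z + 8 * k\<^sup>2) = x\<^sup>2" using \<open>b > 0\<close> by simp
  ultimately obtain q where q: "q \<ge> 0" "z + 8 * k\<^sup>2 = q\<^sup>2"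
    using coprime_mult_eq_square_int(2) [of "P - 1" "z + 8 * k\<^sup>2" x] \<open>R > 0\<close> R \<open>z > 0\<close> by auto
  have "2 * b * ((z - 1) * R) = 2 * b * y\<^sup>2"
    using pell unfolding b_def [symmetric] z by algebra
  hence zR: "(z - 1) * R = y\<^sup>2" using \<open>b > 0\<close> by simp
  have "coprime (z - 1) R"
  proof -
    have "coprime (8 * k\<^sup>2 * m) (b * R)" unfolding bR by simp
    moreover have "odd (b * R)" unfolding bR by simp
    hence "coprime 2 (b * R)" by simp
    ultimately have "coprime (2 * (8 * k\<^sup>2 * m)) (b * R)"
      using coprime_mult_left_iff by blast
    thus ?thesis using m by simp
  qed
  then obtain w r where w: "w \<ge> 0" "z - 1 = w\<^sup>2" and r: "r \<ge> 0" "R = r\<^sup>2"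
    using coprime_mult_eq_square_int [OF _ zR] \<open>z > 0\<close> \<open>R > 0\<close> by auto
  have "(4 * k)\<^sup>2 dvd w\<^sup>2" using m w by simp
  hence "4 * k dvd w" by (subst (asm) pow_divides_pow_iff) auto
  then obtain v where v: "w = 4 * k * v" by auto
  have qw: "q\<^sup>2 = w\<^sup>2 + 8 * k\<^sup>2 + 1" using q w by simp
  have "w\<^sup>2 < q\<^sup>2" unfolding qw using zero_le_power2 [of k] by linarith
  hence "w < q" using q(1) by (rule power2_less_imp_less)
  \<comment> \<open>The gap q^2 - w^2 = 8 k^2 + 1 is at least 2 w + 1, so w \<le> 4 k^2.\<close>
  hence "(w + 1)\<^sup>2 \<le> q\<^sup>2" using w by (intro power_mono) auto
  hence "4 * k * v \<le> 4 * k * k"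
    using qw v by (simp add: power2_eq_square algebra_simps)
  hence "v \<le> k" using \<open>k > 0\<close> by simp
  have "v \<ge> 0" using w(1) v \<open>k > 0\<close> by (simp add: zero_le_mult_iff)
  \<comment> \<open>Both sides are z + 1, computed from z - 1 = w^2 and from R = r^2.\<close>
  have "2 * (8 * k\<^sup>2 * v\<^sup>2 + 1) = 2 * (b * r\<^sup>2)" using z w(2) r v by (simp add: power_mult_distrib)
  hence rv: "r\<^sup>2 - 1 = 8 * k\<^sup>2 * (v\<^sup>2 - r\<^sup>2)" by (simp add: b_def algebra_simps)
  have "R = 1"
  proof (rule ccontr)
    \<comment> \<open>Here r^2 > 1 forces v^2 > r^2, hence r^2 - 1 \<ge> 8 k^2 and v^2 > 8 k^2,
      against v \<le> k.\<close>
    assume "R \<noteq> 1"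
    hence "r\<^sup>2 - 1 > 0" using r(2) \<open>R > 0\<close> by linarith
    hence "v\<^sup>2 - r\<^sup>2 > 0" using rv \<open>k > 0\<close> by (simp add: zero_less_mult_iff)
    hence "8 * k\<^sup>2 * 1 \<le> 8 * k\<^sup>2 * (v\<^sup>2 - r\<^sup>2)" by (intro mult_left_mono) auto
    hence "8 * k\<^sup>2 < v\<^sup>2" using rv \<open>v\<^sup>2 - r\<^sup>2 > 0\<close> by linarith
    moreover have "v\<^sup>2 \<le> k\<^sup>2" using \<open>v \<le> k\<close> \<open>v \<ge> 0\<close> by (intro power_mono) auto
    ultimately show False using zero_le_power2 [of k] by linarith
  qed
  hence "z = 16 * k\<^sup>2 + 1" using z b_def by simp
  thus "y\<^sup>2 = 16 * k\<^sup>2" using zR \<open>R = 1\<close> by simp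
  have "24 * k\<^sup>2 + 1 = q\<^sup>2" using q \<open>z = 16 * k\<^sup>2 + 1\<close> by simp
  thus "is_perfect_square (24 * k\<^sup>2 + 1)" unfolding is_perfect_square_def by blast
qed

theorem theorem2:
  fixes k d :: int
  assumes "k > 0"
    and "D_quadruple (- 8 * k ^ 2) {1, 8 * k ^ 2, 8 * k ^ 2 + 1, d}"
  shows "d = 32 * k ^ 2 + 1 \<and> is_perfect_square (24 * k ^ 2 + 1)"
proof -
  let ?S = "{1, 8 * k\<^sup>2, 8 * k\<^sup>2 + 1, d}"
  have card: "card ?S = 4"
    and sq: "\<And>a b. a \<in> ?S \<Longrightarrow> b \<in> ?S \<Longrightarrow> a \<noteq> b \<Longrightarrow> is_perfect_square (a * b + (- 8 * k\<^sup>2))"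
    using assms(2) unfolding D_tuple_def by blast+
  have "d \<notin> {1, 8 * k\<^sup>2, 8 * k\<^sup>2 + 1}"
  proof
    assume "d \<in> {1, 8 * k\<^sup>2, 8 * k\<^sup>2 + 1}"
    hence "?S = {1, 8 * k\<^sup>2, 8 * k\<^sup>2 + 1}" by auto
    moreover have "card {1, 8 * k\<^sup>2, 8 * k\<^sup>2 + 1} \<le> 3"
      by (simp add: card_insert_if)
    ultimately show False using card by simp
  qed
  hence d: "d \<noteq> 1" "d \<noteq> 8 * k\<^sup>2" "d \<noteq> 8 * k\<^sup>2 + 1" by auto
  obtain x where x: "d - 8 * k\<^sup>2 = x\<^sup>2"
    using sq [of 1 d] d by (auto simp: is_perfect_square_def)
  obtain t where t: "8 * k\<^sup>2 * d - 8 * k\<^sup>2 = t\<^sup>2"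
    using sq [of "8 * k\<^sup>2" d] d by (auto simp: is_perfect_square_def)
  obtain z0 where z0: "(8 * k\<^sup>2 + 1) * d - 8 * k\<^sup>2 = z0\<^sup>2"
    using sq [of "8 * k\<^sup>2 + 1" d] d by (auto simp: is_perfect_square_def)
  \<comment> \<open>Removing the square (2 k)^2 leaves 2 (d - 1) as an even square, so d - 1 is
    twice a square.\<close>
  have t': "t\<^sup>2 = (2 * k)\<^sup>2 * (2 * (d - 1))" using t by (simp add: algebra_simps)
  hence "(2 * k)\<^sup>2 dvd t\<^sup>2" by (metis dvd_triv_left)
  hence "2 * k dvd t" by (subst (asm) pow_divides_pow_iff) auto
  then obtain s where "t = 2 * k * s" by auto
  hence s: "s\<^sup>2 = 2 * (d - 1)" using t' \<open>k > 0\<close> by (simp add: power_mult_distrib)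
  hence "even (s\<^sup>2)" by simp
  hence "even s" by simp
  then obtain y0 where "s = 2 * y0" by auto
  define y z where "y = \<bar>y0\<bar>" and "z = \<bar>z0\<bar>"
  have y: "d = 2 * y\<^sup>2 + 1" using s \<open>s = 2 * y0\<close> by (simp add: y_def power_mult_distrib)
  have pell: "z\<^sup>2 = 2 * (8 * k\<^sup>2 + 1) * y\<^sup>2 + 1"
    using z0 unfolding y by (simp add: z_def algebra_simps)
  \<comment> \<open>The descent applies with a = 4 k.\<close>
  have "2 * (8 * k\<^sup>2 + 1) = (4 * k)\<^sup>2 + 2" by (simp add: power_mult_distrib)
  hence "z\<^sup>2 = ((4 * k)\<^sup>2 + 2) * y\<^sup>2 + 1" using pell by simp
  from pell_square_plus_two_cong [OF _ _ _ this]
  have "(4 * k)\<^sup>2 dvd z - 1" "(4 * k)\<^sup>2 + 2 dvd z - 1 \<or> (4 * k)\<^sup>2 + 2 dvd z + 1"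
    using \<open>k > 0\<close> by (auto simp: y_def z_def)
  hence dvd: "16 * k\<^sup>2 dvd z - 1" "8 * k\<^sup>2 + 1 dvd z - 1 \<or> 8 * k\<^sup>2 + 1 dvd z + 1"
    using \<open>2 * (8 * k\<^sup>2 + 1) = (4 * k)\<^sup>2 + 2\<close> by (simp, metis dvd_mult_right)
  have fac: "(z - 8 * k\<^sup>2) * (z + 8 * k\<^sup>2) = (8 * k\<^sup>2 + 1) * x\<^sup>2"
  proof -
    have "(z - 8 * k\<^sup>2) * (z + 8 * k\<^sup>2) = z\<^sup>2 - (8 * k\<^sup>2)\<^sup>2" by algebra
    also have "\<dots> = (8 * k\<^sup>2 + 1) * (2 * y\<^sup>2 + 1 - 8 * k\<^sup>2)" unfolding pell by algebra
    finally show ?thesis using x y by simp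
  qed
  have "odd (z\<^sup>2)" unfolding pell by simp
  hence "z > 0" by (cases "z = 0") (auto simp: z_def)
  \<comment> \<open>This makes z - 8 k^2 nonnegative, as extracting squares from coprime factors
    requires.\<close>
  have "(8 * k\<^sup>2)\<^sup>2 \<le> z\<^sup>2"
  proof -
    have "0 \<le> (8 * k\<^sup>2 + 1) * x\<^sup>2" by simp
    thus ?thesis using fac by (simp add: algebra_simps power2_eq_square)
  qed
  hence "8 * k\<^sup>2 \<le> z" by (rule power2_le_imp_le) (use \<open>z > 0\<close> in simp)
  \<comment> \<open>The solution y = 0 is d = 1, excluded by distinctness; this rules out b dividing
    z - 1.\<close>
  have "y \<noteq> 0" using y d by auto
  hence "8 * k\<^sup>2 + 1 dvd z + 1"
    using pell_system_dvd_minus_one [OF \<open>z > 0\<close> dvd(1) _ pell fac \<open>8 * k\<^sup>2 \<le> z\<close>] dvd(2)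
    by blast
  from pell_system_dvd_plus_one [OF \<open>k > 0\<close> \<open>z > 0\<close> dvd(1) this pell fac \<open>8 * k\<^sup>2 \<le> z\<close>]
  show ?thesis using y by simp
qed

end
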